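(* Let $d\ge 2$ be an integer. There exist a constant $C_d>0$ and an integer $n_0(d)$ such that for every $n\ge n_0(d)$ the following holds: if $\mathcal{F}\subseteq\binom{[n]}{d+1}$ has VC-dimension at most $d$, then $$|\mathcal{F}|\le\binom{n-1}{d}+C_d\, n^{\,d-1-\frac{1}{4d-2}}.$$
   Context: $\binom{[n]}{k}$ denotes the family of all $k$-element subsets of $[n]=\{1,\dots,n\}$. A family $\mathcal{F}$ of subsets of $[n]$ shatters a set $S\subseteq[n]$ if for every $A\subseteq S$ there is $F\in\mathcal{F}$ with $F\cap S=A$. The VC-dimension of $\mathcal{F}$ is the largest size of a set shattered by $\mathcal{F}$. *)

theory Defs
  imports Complex_Main
begin

definition shatters :: "nat set set \<Rightarrow> nat set \<Rightarrow> bool" where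
  "shatters F S \<longleftrightarrow> (\<forall>A\<subseteq>S. \<exists>X\<in>F. X \<inter> S = A)"

definition vc_dim_le :: "nat \<Rightarrow> nat set set \<Rightarrow> nat \<Rightarrow> bool" where
  "vc_dim_le n F d \<longleftrightarrow> (\<forall>S. S \<subseteq> {1..n} \<and> shatters F S \<longrightarrow> card S \<le> d)"

end

theory Submission
  imports Defs
begin

text \<open>
  Call a \<open>d\<close>-set own if exactly one member of \<open>F\<close> contains it. Members with an own subset are
  at most as many as the own sets, so \<open>card F \<le> (n choose d) - N + R\<close>, where \<open>N\<close> counts the
  \<open>d\<close>-sets that are not own and \<open>R\<close> the ownless members. It remains to prove
  \<open>N \<ge> R + (n choose (d - 1)) - error\<close>.

  Each ownless member \<open>X\<close> misses a trace \<open>B\<close>, chosen as large as possible. Then \<open>card B \<le> d - 1\<close>,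
  and only \<open>O(n ^ (d - 2))\<close> members have \<open>card B \<le> d - 2\<close>, because such an \<open>X\<close> realizes every
  trace that is larger than \<open>B\<close>. In particular \<open>R = O(n ^ (d - 1))\<close>, so if \<open>F\<close> is
  large then all but \<open>O(n ^ (d - 1))\<close> of the \<open>d\<close>-sets \<open>A\<close> are good: \<open>A\<close> is own and
  every other \<open>d\<close>-subset of its member \<open>insert (hub A) A\<close> is not.

  All but \<open>O(n ^ (d - 1) / K)\<close> of the \<open>(d - 1)\<close>-sets \<open>B\<close> are typical: all but \<open>K\<close> of their
  one-point extensions are good. The hubs of these lie in a set of at most \<open>K\<close> points, so some
  extension \<open>insert x B\<close> is heavy, that is, it lies in many members. A heavy set contains at most one
  typical set. So \<open>N\<close> is at least the number of typical sets, plus the number of typical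
  sets with a second heavy extension, plus the number of light sets (neither own nor heavy).

  An ownless member with trace \<open>B\<close> contains \<open>x\<close> for every heavy extension \<open>insert x B\<close>. If there are
  two such extensions, the member is determined by \<open>B\<close>. If there is only one, removing \<open>x\<close> from the
  member leaves a light set, and this set determines the member unless \<open>B\<close> is one of the few sets whose
  heavy point differs from that of most sets sharing \<open>d - 2\<close> points with \<open>B\<close>. The choice
  \<open>K \<approx> n powr (1 / 3)\<close> balances the errors \<open>n ^ (d - 1) / K\<close> and \<open>K ^ 2 * n ^ (d - 2)\<close>.
\<close>

section \<open>Counting by branching and a majority principle\<close>

lemma card_layer_le_power:
  assumes "finite V"
  shows "card {A. A \<subseteq> V \<and> card A = j} \<le> card V ^ j"
  by (cases "j \<le> card V") (use assms in \<open>auto simp: n_subsets binomial_le_pow binomial_eq_0\<close>)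

lemma card_supersets_le_power:
  assumes V: "finite V" and P: "P \<subseteq> {X. X \<subseteq> V \<and> card X = k}"
  shows "card {X \<in> P. S \<subseteq> X} \<le> card V ^ (k - card S)"
proof -
  have fin: "finite {A. A \<subseteq> V \<and> card A = k - card S}"
    using V by simp
  have inj: "inj_on (\<lambda>X. X - S) {X \<in> P. S \<subseteq> X}"
    by (rule inj_on_inverseI[of _ "\<lambda>Z. Z \<union> S"]) auto
  have "(\<lambda>X. X - S) ` {X \<in> P. S \<subseteq> X} \<subseteq> {A. A \<subseteq> V \<and> card A = k - card S}"
  proof (intro image_subsetI CollectI)
    fix X assume "X \<in> {X \<in> P. S \<subseteq> X}"
    then have "S \<subseteq> X" "X \<subseteq> V" "card X = k" using P by auto
    then show "X - S \<subseteq> V \<and> card (X - S) = k - card S"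
      using finite_subset[OF _ V] by (auto simp: card_Diff_subset)
  qed
  then have "card {X \<in> P. S \<subseteq> X} \<le> card {A. A \<subseteq> V \<and> card A = k - card S}"
    using card_inj_on_le[OF inj _ fin] by blast
  also have "\<dots> \<le> card V ^ (k - card S)"
    using card_layer_le_power[OF V] .
  finally show ?thesis .
qed

text \<open>Branching: a set \<open>S\<close> with fewer than \<open>q\<close> elements that is met by a
  small set \<open>L\<close> outside \<open>S\<close> can be enlarged in at most \<open>card L\<close> ways.\<close>

lemma card_le_by_branching:
  assumes V: "finite V" and P: "P \<subseteq> {X. X \<subseteq> V \<and> card X = k}"
    and branch: "\<And>S X. X \<in> P \<Longrightarrow> B \<subseteq> S \<Longrightarrow> S \<subseteq> X \<Longrightarrow> card S < q \<Longrightarrow>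
      \<exists>L. finite L \<and> card L \<le> k \<and> L \<inter> S = {} \<and> (\<forall>Y\<in>P. S \<subseteq> Y \<longrightarrow> Y \<inter> L \<noteq> {})"
    and "B \<subseteq> S" "finite S" "card S + i = q"
  shows "card {X \<in> P. S \<subseteq> X} \<le> k ^ i * card V ^ (k - q)"
  using assms(4-)
proof (induction i arbitrary: S)
  case 0
  then show ?case using card_supersets_le_power[OF V P, of S] by simp
next
  case (Suc i)
  have finP: "finite P"
    using P V by (auto intro: finite_subset[of _ "Pow V"])
  show ?case
  proof (cases "{X \<in> P. S \<subseteq> X} = {}")
    case True
    then show ?thesis by (simp only: card.empty le0)
  next
    case False
    then obtain X where "X \<in> P" "S \<subseteq> X" by blast
    then obtain L where L: "finite L" "card L \<le> k" "L \<inter> S = {}"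
      and meet: "\<forall>Y\<in>P. S \<subseteq> Y \<longrightarrow> Y \<inter> L \<noteq> {}"
      using branch[of X S] Suc.prems by auto
    have step: "card {X \<in> P. insert l S \<subseteq> X} \<le> k ^ i * card V ^ (k - q)" if "l \<in> L" for l
    proof (rule Suc.IH)
      have "l \<notin> S" using L(3) that by blast
      then show "card (insert l S) + i = q" using Suc.prems by simp
    qed (use Suc.prems in auto)
    have "{X \<in> P. S \<subseteq> X} \<subseteq> (\<Union>l\<in>L. {X \<in> P. insert l S \<subseteq> X})"
      using meet by fastforce
    then have "card {X \<in> P. S \<subseteq> X} \<le> card (\<Union>l\<in>L. {X \<in> P. insert l S \<subseteq> X})"
      using finP L(1) by (intro card_mono) auto
    also have "\<dots> \<le> (\<Sum>l\<in>L. card {X \<in> P. insert l S \<subseteq> X})"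
      using L(1) by (rule card_UN_le)
    also have "\<dots> \<le> card L * (k ^ i * card V ^ (k - q))"
      using sum_bounded_above[OF step, of L] by simp
    also have "\<dots> \<le> k * (k ^ i * card V ^ (k - q))"
      using L(2) by (rule mult_right_mono) simp
    finally show ?thesis by (simp add: mult.assoc)
  qed
qed

text \<open>In the digraph \<open>R\<close> on \<open>Y\<close> the in-degrees and the out-degrees
  have the same sum, so if \<open>Y\<close> is nonempty, some \<open>z\<close> has in-degree at most
  \<open>m\<close>. Every vertex coloured differently from \<open>z\<close> is joined to
  \<open>z\<close> by an arc; hence the colour of \<open>z\<close> serves as
  \<open>v\<close>.\<close>

lemma majority_colour:
  fixes c :: "'a \<Rightarrow> 'b"
  assumes Y: "finite Y"
    and out: "\<And>b. b \<in> Y \<Longrightarrow> card {z \<in> Y. R b z} \<le> m"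
    and arc: "\<And>b z. b \<in> Y \<Longrightarrow> z \<in> Y \<Longrightarrow> c b \<noteq> c z \<Longrightarrow> R b z \<or> R z b"
  shows "\<exists>v. card {b \<in> Y. c b \<noteq> v} \<le> 2 * m"
proof (cases "Y = {}")
  case True
  then show ?thesis by simp
next
  case False
  have "\<exists>z\<in>Y. card {b \<in> Y. R b z} \<le> m"
  proof (rule ccontr)
    assume "\<not> ?thesis"
    then have "m < card {b \<in> Y. R b z}" if "z \<in> Y" for z
      using that not_le by blast
    with Y False have "(\<Sum>z\<in>Y. m) < (\<Sum>z\<in>Y. card {b \<in> Y. R b z})"
      by (rule sum_strict_mono)
    also have "\<dots> = (\<Sum>b\<in>Y. card {z \<in> Y. R b z})"
      using sum.swap_restrict[OF Y Y, of "\<lambda>_ _. 1::nat" R] Y by simp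
    also have "\<dots> \<le> (\<Sum>b\<in>Y. m)"
      using out by (intro sum_mono)
    finally show False by simp
  qed
  then obtain z where z: "z \<in> Y" "card {b \<in> Y. R b z} \<le> m" by blast
  have "{b \<in> Y. c b \<noteq> c z} \<subseteq> {b \<in> Y. R b z} \<union> {b \<in> Y. R z b}"
    using arc z(1) by blast
  then have "card {b \<in> Y. c b \<noteq> c z} \<le> card ({b \<in> Y. R b z} \<union> {b \<in> Y. R z b})"
    using Y by (intro card_mono) auto
  also have "\<dots> \<le> card {b \<in> Y. R b z} + card {b \<in> Y. R z b}"
    by (rule card_Un_le)
  also have "\<dots> \<le> 2 * m"
    using z out[OF z(1)] by simp
  finally show ?thesis by blast
qed

section \<open>Own sets, hubs and missing traces\<close>

text \<open>The bound on the VC-dimension enters as \<open>missing_trace\<close>: a member has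
  \<open>d + 1\<close> points, so it is not shattered.\<close>

locale traced_family =
  fixes V :: "'a set" and F :: "'a set set" and d :: nat
  assumes finite_V: "finite V" and d_ge_2: "2 \<le> d"
    and uniform: "X \<in> F \<Longrightarrow> X \<subseteq> V \<and> card X = d + 1"
    and missing_trace: "X \<in> F \<Longrightarrow> \<exists>B\<subseteq>X. \<forall>Y\<in>F. Y \<inter> X \<noteq> B"
begin

abbreviation n :: nat where "n \<equiv> card V"

definition layer :: "nat \<Rightarrow> 'a set set" where
  "layer j = {A. A \<subseteq> V \<and> card A = j}"

definition own :: "'a set \<Rightarrow> bool" where
  "own A \<longleftrightarrow> A \<in> layer d \<and> (\<exists>!X. X \<in> F \<and> A \<subseteq> X)"

definition ownless :: "'a set set" where
  "ownless = {X \<in> F. \<forall>A\<subseteq>X. \<not> own A}"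

definition good :: "'a set \<Rightarrow> bool" where
  "good A \<longleftrightarrow> own A \<and> (\<forall>X\<in>F. A \<subseteq> X \<longrightarrow> (\<forall>A'\<subseteq>X. own A' \<longrightarrow> A' = A))"

definition hub :: "'a set \<Rightarrow> 'a" where
  "hub A = (THE x. x \<notin> A \<and> insert x A \<in> F)"

definition missing :: "'a set \<Rightarrow> 'a set \<Rightarrow> bool" where
  "missing X B \<longleftrightarrow> B \<subseteq> X \<and> (\<forall>Y\<in>F. Y \<inter> X \<noteq> B)"

definition trace :: "'a set \<Rightarrow> 'a set" where
  "trace X = (SOME B. missing X B \<and> (\<forall>B'. missing X B' \<longrightarrow> card B' \<le> card B))"

definition traced :: "'a set \<Rightarrow> 'a set set" where
  "traced B = {X \<in> ownless. trace X = B}"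

lemma finite_layer [simp]: "finite (layer j)"
  by (simp add: layer_def finite_V)

lemma card_layer: "card (layer j) = n choose j"
  by (simp add: layer_def n_subsets finite_V)

lemma card_layer_le: "card (layer j) \<le> n ^ j"
  using card_layer_le_power[OF finite_V] by (simp add: layer_def)

lemma finite_F [simp]: "finite F"
  using uniform finite_V by (auto intro: finite_subset[of _ "Pow V"])

lemma finite_ownless [simp]: "finite ownless"
  by (rule finite_subset[OF _ finite_F]) (auto simp: ownless_def)

lemma finite_traced [simp]: "finite (traced B)"
  by (rule finite_subset[OF _ finite_ownless]) (auto simp: traced_def)

lemma finite_member: "X \<in> F \<Longrightarrow> finite X"
  using uniform finite_V finite_subset by blast

lemma finite_layerD: "A \<in> layer j \<Longrightarrow> finite A"
  using finite_V finite_subset by (auto simp: layer_def)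

lemma insert_layer: "B \<in> layer j \<Longrightarrow> z \<in> V - B \<Longrightarrow> insert z B \<in> layer (Suc j)"
  using finite_layerD[of B j] by (auto simp: layer_def)

lemma remove_layer: "A \<in> layer (Suc j) \<Longrightarrow> z \<in> A \<Longrightarrow> A - {z} \<in> layer j"
  using finite_layerD[of A "Suc j"] by (auto simp: layer_def)

lemma member_eqI: "X \<in> F \<Longrightarrow> Y \<in> F \<Longrightarrow> X \<subseteq> Y \<Longrightarrow> X = Y"
  using uniform[of X] uniform[of Y] finite_member[of Y] card_subset_eq[of Y X] by simp

lemma member_layer: "X \<in> F \<Longrightarrow> X \<in> layer (Suc d)"
  using uniform by (auto simp: layer_def)

lemma layer_superset_eq_insert:
  assumes "A \<in> layer j" "X \<in> layer (Suc j)" "A \<subseteq> X"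
  obtains x where "x \<in> V - A" "X = insert x A"
proof -
  have "card (X - A) = card X - card A"
    using assms finite_layerD by (intro card_Diff_subset) blast+
  then have "card (X - A) = 1"
    using assms by (simp add: layer_def)
  then obtain x where "X - A = {x}"
    using card_1_singletonE by blast
  then show ?thesis
    using that[of x] assms by (fastforce simp: layer_def)
qed

lemma hub:
  assumes "own A"
  shows "hub A \<in> V - A" "insert (hub A) A \<in> F"
proof -
  obtain X where X: "X \<in> F" "A \<subseteq> X" and uniq: "\<And>Y. Y \<in> F \<Longrightarrow> A \<subseteq> Y \<Longrightarrow> Y = X"
    using assms by (auto simp: own_def)
  obtain x where x: "x \<in> V - A" "X = insert x A"
    using layer_superset_eq_insert[OF _ member_layer[OF X(1)] X(2)] assms unfolding own_def by blast
  have "\<exists>!x. x \<notin> A \<and> insert x A \<in> F"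
  proof (rule ex1I[of _ x])
    show "x \<notin> A \<and> insert x A \<in> F" using x X by auto
  next
    fix y assume y: "y \<notin> A \<and> insert y A \<in> F"
    then show "y = x" using uniq[of "insert y A"] x by blast
  qed
  from theI'[OF this] have h: "hub A \<notin> A" "insert (hub A) A \<in> F"
    by (auto simp: hub_def)
  show "insert (hub A) A \<in> F" by (rule h(2))
  show "hub A \<in> V - A"
    using uniform[OF h(2)] h(1) by simp
qed

lemma own_unique:
  assumes "own A" "X \<in> F" "A \<subseteq> X" "Y \<in> F" "A \<subseteq> Y"
  shows "X = Y"
proof -
  obtain Z where "\<And>Y. Y \<in> F \<and> A \<subseteq> Y \<Longrightarrow> Y = Z"
    using assms(1) unfolding own_def by (elim conjE ex1E) metis
  then show ?thesis using assms by metis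
qed

lemma hub_unique:
  assumes "own A" "y \<notin> A" "insert y A \<in> F"
  shows "hub A = y"
proof -
  have "insert (hub A) A = insert y A"
    using own_unique[OF assms(1) hub(2)[OF assms(1)] _ assms(3)] by blast
  then show ?thesis using assms(2) hub(1)[OF assms(1)] by (metis DiffD2 insertE insertI1)
qed

lemma goodD: "good A \<Longrightarrow> own A"
  by (simp add: good_def)

lemma good_not_own:
  assumes "good A" "b \<in> A"
  shows "\<not> own (insert (hub A) A - {b})"
proof
  assume own: "own (insert (hub A) A - {b})"
  have "\<forall>A'\<subseteq>insert (hub A) A. own A' \<longrightarrow> A' = A"
    using assms(1) hub(2)[of A] unfolding good_def by (meson subset_insertI)
  with own have "insert (hub A) A - {b} = A"
    by (meson Diff_subset)
  with assms(2) show False by blast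
qed

lemma trace:
  assumes "X \<in> F"
  shows "missing X (trace X)" "missing X B' \<Longrightarrow> card B' \<le> card (trace X)"
proof -
  obtain B where B: "missing X B"
    using missing_trace[OF assms] by (auto simp: missing_def)
  have bound: "\<forall>B. missing X B \<longrightarrow> card B \<le> d + 1"
    using uniform[OF assms] finite_member[OF assms] by (metis card_mono missing_def)
  have "\<exists>B. missing X B \<and> (\<forall>B'. missing X B' \<longrightarrow> card B' \<le> card B)"
    using ex_has_greatest_nat[of "missing X" B card "d + 2"] B bound by force
  from someI_ex[OF this]
  show "missing X (trace X)" "missing X B' \<Longrightarrow> card B' \<le> card (trace X)"
    by (auto simp: trace_def)
qed

text \<open>A second member containing the \<open>d\<close>-set \<open>A\<close> would meet
  \<open>X\<close> in a proper subset of \<open>X\<close> that includes \<open>A\<close>, hence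
  exactly in \<open>A\<close>, although this trace is missing.\<close>

lemma own_of_missing:
  assumes "X \<in> F" "missing X A" "card A = d"
  shows "own A"
  unfolding own_def
proof (intro conjI ex1I[of _ X])
  show "A \<in> layer d"
    using assms uniform by (auto simp: layer_def missing_def)
  show "X \<in> F" "A \<subseteq> X"
    using assms by (auto simp: missing_def)
next
  fix Y assume Y: "Y \<in> F \<and> A \<subseteq> Y"
  show "Y = X"
  proof (rule ccontr)
    assume "Y \<noteq> X"
    then have "\<not> X \<subseteq> Y"
      using member_eqI[OF assms(1), of Y] Y by blast
    then have "Y \<inter> X \<subset> X"
      by blast
    then have "card (Y \<inter> X) \<le> d"
      using psubset_card_mono[OF finite_member[OF assms(1)], of "Y \<inter> X"] uniform[OF assms(1)] by simp
    moreover have "A \<subseteq> Y \<inter> X" using Y assms by (auto simp: missing_def)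
    ultimately have "A = Y \<inter> X"
      using assms finite_member[OF assms(1)] card_seteq[of "Y \<inter> X" A] by simp
    then show False using assms Y by (auto simp: missing_def)
  qed
qed

text \<open>A trace does not have \<open>d + 1\<close> points, since \<open>X\<close> itself
  realizes \<open>X\<close>, and not \<open>d\<close> points, since \<open>X\<close> has no own
  subset. The last claim drives the branching: each member above \<open>B\<close> meets
  \<open>X\<close> outside \<open>B\<close>.\<close>

lemma tracedD:
  assumes "X \<in> traced B"
  shows "X \<in> ownless" "X \<in> F" "B \<subseteq> X" "B \<subseteq> V" "card B \<le> d - 1"
    and "Y \<in> F \<Longrightarrow> B \<subseteq> Y \<Longrightarrow> \<exists>l\<in>X. l \<in> Y - B"
proof -
  show X: "X \<in> ownless" "X \<in> F"
    using assms by (auto simp: traced_def ownless_def)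
  have B: "missing X B"
    using trace(1)[OF X(2)] assms by (simp add: traced_def)
  then show BX: "B \<subseteq> X" by (simp add: missing_def)
  then show "B \<subseteq> V" using uniform[OF X(2)] by blast
  have "card B \<le> d + 1"
    using BX X(2) uniform finite_member by (metis card_mono)
  moreover have "card B \<noteq> d + 1"
    using BX X(2) B uniform finite_member
    by (metis card_subset_eq inf.idem missing_def)
  moreover have "card B \<noteq> d"
    using own_of_missing[OF X(2) B] X(1) BX by (auto simp: ownless_def)
  ultimately show "card B \<le> d - 1" by simp
  show "\<exists>l\<in>X. l \<in> Y - B" if "Y \<in> F" "B \<subseteq> Y"
    using B that by (auto simp: missing_def)
qed

lemma ownless_avoid:
  assumes "X \<in> ownless" "x \<in> X"
  obtains Y where "Y \<in> F" "X - {x} \<subseteq> Y" "x \<notin> Y"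
proof -
  have X: "X \<in> F" using assms by (simp add: ownless_def)
  have A: "X - {x} \<in> layer d"
    using remove_layer[OF member_layer[OF X] assms(2)] .
  have "\<not> own (X - {x})" using assms by (auto simp: ownless_def)
  then obtain Y where Y: "Y \<in> F" "X - {x} \<subseteq> Y" "Y \<noteq> X"
    using A X by (metis Diff_subset own_def)
  have "x \<notin> Y"
  proof
    assume "x \<in> Y"
    then have "X \<subseteq> Y" using Y by blast
    then show False
      using Y X member_eqI by blast
  qed
  then show ?thesis using that Y by blast
qed

section \<open>Members with a prescribed trace\<close>

text \<open>Two branching steps lead from the \<open>d - 1\<close> points of \<open>B\<close> to all
  \<open>d + 1\<close> points of a member, so no power of \<open>n\<close> remains.\<close>

lemma card_traced_le:
  assumes B: "card B = d - 1"
  shows "card (traced B) \<le> (d + 1) ^ 2"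
proof (cases "B \<subseteq> V")
  case True
  have P: "traced B \<subseteq> {X. X \<subseteq> V \<and> card X = d + 1}"
    using tracedD(2) uniform by blast
  have branch: "\<exists>L. finite L \<and> card L \<le> d + 1 \<and> L \<inter> S = {} \<and> (\<forall>Y\<in>traced B. S \<subseteq> Y \<longrightarrow> Y \<inter> L \<noteq> {})"
    if X: "X \<in> traced B" and S: "B \<subseteq> S" "S \<subseteq> X" "card S < d + 1" for S X
  proof -
    \<comment> \<open>The branching set will be \<open>Z - B\<close>. In the first step
      \<open>Z = X\<close> works; in the second, where \<open>S = insert x B\<close>, a member
      through \<open>X - {x}\<close> that avoids \<open>x\<close>.\<close>
    have "\<exists>Z\<in>F. B \<subseteq> Z \<and> (Z - B) \<inter> S = {}"
    proof (cases "S = B")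
      case True
      then show ?thesis using tracedD[OF X] by (intro bexI[of _ X]) auto
    next
      case False
      have "finite S" using S(2) finite_member[OF tracedD(2)[OF X]] finite_subset by blast
      then have "card B < card S" using S(1) False by (simp add: psubset_card_mono psubset_eq)
      then have "card (S - B) = 1"
        using S B \<open>finite S\<close> d_ge_2 finite_subset[OF S(1)] by (simp add: card_Diff_subset)
      then obtain x where x: "S - B = {x}" using card_1_singletonE by blast
      then obtain Y where "Y \<in> F" "X - {x} \<subseteq> Y" "x \<notin> Y"
        using ownless_avoid[OF tracedD(1)[OF X], of x] S by blast
      then show ?thesis using x S by (intro bexI[of _ Y]) auto
    qed
    then obtain Z where Z: "Z \<in> F" "B \<subseteq> Z" "(Z - B) \<inter> S = {}" by blast
    have "card (Z - B) \<le> d + 1"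
      using uniform[OF Z(1)] finite_member[OF Z(1)] by (metis Diff_subset card_mono)
    moreover have "\<forall>Y\<in>traced B. S \<subseteq> Y \<longrightarrow> Y \<inter> (Z - B) \<noteq> {}"
      using tracedD(6) Z by blast
    ultimately show ?thesis
      using Z finite_member by (intro exI[of _ "Z - B"]) auto
  qed
  have "card {X \<in> traced B. B \<subseteq> X} \<le> (d + 1) ^ 2 * n ^ (d + 1 - (d + 1))"
    using card_le_by_branching[OF finite_V P, of B "d + 1" B 2] branch B d_ge_2
      finite_subset[OF True finite_V] by simp
  moreover have "{X \<in> traced B. B \<subseteq> X} = traced B" using tracedD(3) by blast
  ultimately show ?thesis by simp
next
  case False
  then have "traced B = {}" using tracedD(4) by blast
  then show ?thesis by simp
qed

text \<open>As \<open>card B + 3 \<le> d + 1\<close>, there is room for three branching steps. At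
  each of them \<open>X\<close> has a point \<open>x\<close> outside \<open>S\<close>; the set
  \<open>insert x B\<close> is larger than the trace \<open>B\<close>, so some \<open>Z\<close>
  realizes it on \<open>X\<close>, and \<open>Z - B\<close> is disjoint from
  \<open>S\<close>.\<close>

lemma card_traced_small_le:
  assumes B: "card B \<le> d - 2"
  shows "card (traced B) \<le> (d + 1) ^ 3 * n ^ (d - 2 - card B)"
proof (cases "B \<subseteq> V")
  case True
  have P: "traced B \<subseteq> {X. X \<subseteq> V \<and> card X = d + 1}"
    using tracedD(2) uniform by blast
  have branch: "\<exists>L. finite L \<and> card L \<le> d + 1 \<and> L \<inter> S = {} \<and> (\<forall>Y\<in>traced B. S \<subseteq> Y \<longrightarrow> Y \<inter> L \<noteq> {})"
    if X: "X \<in> traced B" and S: "B \<subseteq> S" "S \<subseteq> X" "card S < card B + 3" for S X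
  proof -
    have finS: "finite S" using S(2) finite_member[OF tracedD(2)[OF X]] finite_subset by blast
    have "card S < card X" using S(3) B d_ge_2 uniform[OF tracedD(2)[OF X]] by linarith
    then obtain x where x: "x \<in> X" "x \<notin> S"
      using S(2) by (metis order_less_irrefl subsetI subset_antisym)
    have "card (insert x B) = Suc (card B)"
      using x S(1) finite_subset[OF S(1) finS] by (metis card_insert_disjoint subsetD)
    then have "\<not> missing X (insert x B)"
      using trace(2)[OF tracedD(2)[OF X], of "insert x B"] X by (auto simp: traced_def)
    then obtain Z where Z: "Z \<in> F" "Z \<inter> X = insert x B"
      using x tracedD(3)[OF X] by (auto simp: missing_def)
    have "card (Z - B) \<le> d + 1"
      using uniform[OF Z(1)] finite_member[OF Z(1)] by (metis Diff_subset card_mono)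
    moreover have "\<forall>Y\<in>traced B. S \<subseteq> Y \<longrightarrow> Y \<inter> (Z - B) \<noteq> {}"
      using tracedD(6)[OF _ Z(1)] Z by blast
    moreover have "Z \<inter> S \<subseteq> insert x B" using Z(2) S(2) by blast
    then have "(Z - B) \<inter> S = {}" using x by blast
    ultimately show ?thesis
      using Z finite_member by (intro exI[of _ "Z - B"]) auto
  qed
  have "card {X \<in> traced B. B \<subseteq> X} \<le> (d + 1) ^ 3 * n ^ (d + 1 - (card B + 3))"
    using card_le_by_branching[OF finite_V P, of B "card B + 3" B 3] branch
      finite_subset[OF True finite_V] by simp
  moreover have "{X \<in> traced B. B \<subseteq> X} = traced B" using tracedD(3) by blast
  moreover have "d + 1 - (card B + 3) = d - 2 - card B" by simp
  ultimately show ?thesis by simp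
next
  case False
  then have "traced B = {}" using tracedD(4) by blast
  then show ?thesis by simp
qed


section \<open>Counting own sets, ownless members and good sets\<close>

lemma own_layer: "own A \<Longrightarrow> A \<in> layer d"
  by (simp add: own_def)

lemma finite_own [simp]: "finite (Collect own)"
  using own_layer by (auto intro: finite_subset[OF _ finite_layer[of d]])

lemma finite_good [simp]: "finite (Collect good)"
  using goodD by (auto intro: finite_subset[OF _ finite_own])

lemma sum_own_subsets_le:
  assumes P: "\<And>A. P A \<Longrightarrow> own A"
  shows "(\<Sum>X\<in>F - ownless. card {A. A \<subseteq> X \<and> P A}) \<le> card (Collect P)"
proof -
  have fin: "finite (Collect P)"
    using P by (auto intro: finite_subset[OF _ finite_own])
  have "(\<Sum>X\<in>F - ownless. card {A. A \<subseteq> X \<and> P A})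
      = card (\<Union>X\<in>F - ownless. {A. A \<subseteq> X \<and> P A})"
  proof (rule card_UN_disjoint[symmetric])
    show "\<forall>X\<in>F - ownless. finite {A. A \<subseteq> X \<and> P A}"
      using fin by (auto intro: finite_subset)
    show "\<forall>X\<in>F - ownless. \<forall>Y\<in>F - ownless. X \<noteq> Y \<longrightarrow>
        {A. A \<subseteq> X \<and> P A} \<inter> {A. A \<subseteq> Y \<and> P A} = {}"
      using P own_unique by auto
  qed simp
  also have "\<dots> \<le> card (Collect P)"
    using fin by (intro card_mono) auto
  finally show ?thesis .
qed

lemma finite_own_subsets [simp]: "finite {A. A \<subseteq> X \<and> own A}" "finite {A. A \<subseteq> X \<and> good A}"
  using finite_own finite_good by (auto intro: rev_finite_subset)

lemma card_own_subsets_pos: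
  assumes "X \<in> F - ownless"
  shows "1 \<le> card {A. A \<subseteq> X \<and> own A}"
proof -
  have "{A. A \<subseteq> X \<and> own A} \<noteq> {}"
    using assms by (auto simp: ownless_def)
  then show ?thesis
    using card_gt_0_iff[of "{A. A \<subseteq> X \<and> own A}"] by simp
qed

lemma card_owned_le: "card (F - ownless) \<le> card (Collect own)"
proof -
  have "card (F - ownless) = (\<Sum>X\<in>F - ownless. 1)" by simp
  also have "\<dots> \<le> (\<Sum>X\<in>F - ownless. card {A. A \<subseteq> X \<and> own A})"
    using card_own_subsets_pos by (intro sum_mono)
  also have "\<dots> \<le> card (Collect own)" by (rule sum_own_subsets_le)
  finally show ?thesis .
qed

text \<open>If a member has exactly one own subset, that subset is good. So each member outside
  \<open>ownless\<close> accounts for two units: two own sets, or one own set that is counted again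
  as good.\<close>

lemma double_card_owned_le: "2 * card (F - ownless) \<le> card (Collect own) + card (Collect good)"
proof -
  have two: "2 \<le> card {A. A \<subseteq> X \<and> own A} + card {A. A \<subseteq> X \<and> good A}" if X: "X \<in> F - ownless" for X
  proof (cases "card {A. A \<subseteq> X \<and> own A} = 1")
    case True
    then obtain A where A: "{A. A \<subseteq> X \<and> own A} = {A}"
      by (rule card_1_singletonE)
    have AX: "own A" "A \<subseteq> X" using A by auto
    have "good A"
      unfolding good_def
    proof (intro conjI ballI impI allI)
      fix Y A' assume Y: "Y \<in> F" "A \<subseteq> Y" "A' \<subseteq> Y" "own A'"
      have "Y = X" using own_unique[OF AX(1) Y(1,2), of X] X AX(2) by simp
      then have "A' \<in> {A. A \<subseteq> X \<and> own A}" using Y by simp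
      then show "A' = A" unfolding A by simp
    qed (rule AX(1))
    then have "{A. A \<subseteq> X \<and> good A} \<noteq> {}" using AX by blast
    then have "1 \<le> card {A. A \<subseteq> X \<and> good A}"
      using card_gt_0_iff[of "{A. A \<subseteq> X \<and> good A}"] by simp
    then show ?thesis using True by simp
  next
    case False
    then show ?thesis using card_own_subsets_pos[OF X] by simp
  qed
  have "2 * card (F - ownless) = (\<Sum>X\<in>F - ownless. 2)" by simp
  also have "\<dots> \<le> (\<Sum>X\<in>F - ownless. card {A. A \<subseteq> X \<and> own A} + card {A. A \<subseteq> X \<and> good A})"
    using two by (intro sum_mono)
  also have "\<dots> \<le> card (Collect own) + card (Collect good)"
    unfolding sum.distrib using goodD by (intro add_mono sum_own_subsets_le)
  finally show ?thesis .
qed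

lemma card_small_trace_le:
  "card {X \<in> ownless. card (trace X) \<le> d - 2} \<le> d * (d + 1) ^ 3 * n ^ (d - 2)"
proof -
  have "{X \<in> ownless. card (trace X) \<le> d - 2} \<subseteq> (\<Union>j\<in>{..d - 2}. \<Union>B\<in>layer j. traced B)"
  proof
    fix X assume X: "X \<in> {X \<in> ownless. card (trace X) \<le> d - 2}"
    then have XB: "X \<in> traced (trace X)" by (simp add: traced_def)
    then have "trace X \<in> layer (card (trace X))"
      using tracedD(4) by (simp add: layer_def)
    then show "X \<in> (\<Union>j\<in>{..d - 2}. \<Union>B\<in>layer j. traced B)"
      using X XB by blast
  qed
  then have "card {X \<in> ownless. card (trace X) \<le> d - 2} \<le> card (\<Union>j\<in>{..d - 2}. \<Union>B\<in>layer j. traced B)"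
    by (intro card_mono) auto
  also have "\<dots> \<le> (\<Sum>j\<in>{..d - 2}. card (\<Union>B\<in>layer j. traced B))"
    by (intro card_UN_le) simp
  also have "\<dots> \<le> (\<Sum>j\<in>{..d - 2}. (d + 1) ^ 3 * n ^ (d - 2))"
  proof (rule sum_mono)
    fix j assume j: "j \<in> {..d - 2}"
    have "card (\<Union>B\<in>layer j. traced B) \<le> (\<Sum>B\<in>layer j. card (traced B))"
      by (intro card_UN_le) simp
    also have "\<dots> \<le> (\<Sum>B\<in>layer j. (d + 1) ^ 3 * n ^ (d - 2 - j))"
    proof (rule sum_mono)
      fix B assume "B \<in> layer j"
      then have "card B = j" by (simp add: layer_def)
      then show "card (traced B) \<le> (d + 1) ^ 3 * n ^ (d - 2 - j)"
        using card_traced_small_le[of B] j by simp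
    qed
    also have "\<dots> = card (layer j) * ((d + 1) ^ 3 * n ^ (d - 2 - j))" by simp
    also have "\<dots> \<le> n ^ j * ((d + 1) ^ 3 * n ^ (d - 2 - j))"
      using card_layer_le by (rule mult_right_mono) simp
    also have "\<dots> = (d + 1) ^ 3 * (n ^ j * n ^ (d - 2 - j))"
      by (simp only: mult.left_commute)
    also have "n ^ j * n ^ (d - 2 - j) = n ^ (j + (d - 2 - j))"
      by (rule power_add[symmetric])
    also have "j + (d - 2 - j) = d - 2" using j by simp
    finally show "card (\<Union>B\<in>layer j. traced B) \<le> (d + 1) ^ 3 * n ^ (d - 2)" .
  qed
  also have "\<dots> = card {..d - 2} * ((d + 1) ^ 3 * n ^ (d - 2))"
    by (simp only: sum_constant of_nat_id)
  also have "\<dots> \<le> d * ((d + 1) ^ 3 * n ^ (d - 2))"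
    using d_ge_2 by (intro mult_right_mono) simp_all
  finally show ?thesis by (simp only: mult.assoc)
qed

lemma ownless_split:
  "ownless = {X \<in> ownless. card (trace X) \<le> d - 2} \<union> (\<Union>B\<in>layer (d - 1). traced B)"
proof
  show "ownless \<subseteq> {X \<in> ownless. card (trace X) \<le> d - 2} \<union> (\<Union>B\<in>layer (d - 1). traced B)"
  proof
    fix X assume X: "X \<in> ownless"
    then have XB: "X \<in> traced (trace X)" by (simp add: traced_def)
    have "card (trace X) \<le> d - 2 \<or> card (trace X) = d - 1"
      using tracedD(5)[OF XB] by linarith
    then show "X \<in> {X \<in> ownless. card (trace X) \<le> d - 2} \<union> (\<Union>B\<in>layer (d - 1). traced B)"
      using X XB tracedD(4)[OF XB] by (auto simp: layer_def)
  qed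
qed (auto simp: traced_def)

lemma card_traced_Union_le:
  assumes "S \<subseteq> layer (d - 1)"
  shows "card (\<Union>B\<in>S. traced B) \<le> (d + 1) ^ 2 * card S"
proof -
  have finS: "finite S" using assms finite_layer finite_subset by blast
  have "card (\<Union>B\<in>S. traced B) \<le> (\<Sum>B\<in>S. card (traced B))"
    using finS by (rule card_UN_le)
  also have "\<dots> \<le> (\<Sum>B\<in>S. (d + 1) ^ 2)"
    using assms card_traced_le by (intro sum_mono) (auto simp: layer_def)
  finally show ?thesis by (simp add: mult.commute)
qed

lemma card_ownless_le: "card ownless \<le> 2 * (d + 1) ^ 4 * n ^ (d - 1)"
proof (cases "n = 0")
  \<comment> \<open>For \<open>d = 2\<close> and \<open>n = 0\<close> the power
    \<open>n ^ (d - 2)\<close> is \<open>1\<close> and exceeds \<open>n ^ (d - 1)\<close>, so the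
    empty ground set is treated apart.\<close>
  case True
  then have "V = {}" using finite_V by simp
  then have "F = {}" using uniform by fastforce
  then have "ownless = {}" unfolding ownless_def by blast
  then show ?thesis by simp
next
  case False
  have "card ownless \<le> card {X \<in> ownless. card (trace X) \<le> d - 2} + card (\<Union>B\<in>layer (d - 1). traced B)"
    using ownless_split card_Un_le by metis
  also have "\<dots> \<le> d * (d + 1) ^ 3 * n ^ (d - 2) + (d + 1) ^ 2 * card (layer (d - 1))"
    using card_small_trace_le card_traced_Union_le[OF order.refl] by (rule add_mono)
  also have "\<dots> \<le> (d + 1) ^ 4 * n ^ (d - 1) + (d + 1) ^ 4 * n ^ (d - 1)"
  proof (intro add_mono mult_mono)
    show "d * (d + 1) ^ 3 \<le> (d + 1) ^ 4"
      by (simp add: eval_nat_numeral)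
    show "n ^ (d - 2) \<le> n ^ (d - 1)"
      using False by (intro power_increasing) auto
    show "(d + 1) ^ 2 \<le> (d + 1) ^ 4"
      by (intro power_increasing) auto
  qed (auto intro: card_layer_le)
  finally show ?thesis by simp
qed

text \<open>By \<open>double_card_owned_le\<close>, twice the number of members with an own subset
  is at most twice \<open>n choose d\<close> minus the number of \<open>d\<close>-sets that are not
  good. For large \<open>F\<close> this number is at most
  \<open>2 * ((n - 1) choose (d - 1)) + 2 * card ownless\<close>; the summands give \<open>2\<close>
  and \<open>4\<close> of the factor \<open>6\<close>.\<close>

lemma card_not_good_le:
  assumes "(n - 1) choose d \<le> card F"
  shows "card {A \<in> layer d. \<not> good A} \<le> 6 * (d + 1) ^ 4 * n ^ (d - 1)"
proof (cases "n = 0")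
  case True
  then have "card (layer d) = 0" using d_ge_2 by (simp add: card_layer)
  then have "layer d = {}" by simp
  then show ?thesis by simp
next
  case False
  have split: "card {A \<in> layer d. \<not> good A} + card (Collect good) = n choose d"
  proof -
    have "layer d = {A \<in> layer d. \<not> good A} \<union> Collect good"
      using goodD own_layer by blast
    then have "card (layer d) = card {A \<in> layer d. \<not> good A} + card (Collect good)"
      using card_Un_disjoint[of "{A \<in> layer d. \<not> good A}" "Collect good"] by fastforce
    then show ?thesis by (simp add: card_layer)
  qed
  have "Collect own \<subseteq> layer d" using own_layer by blast
  then have own: "card (Collect own) \<le> n choose d"
    using card_mono[OF finite_layer] by (metis card_layer)
  have F: "card F = card (F - ownless) + card ownless"
    using card_Diff_subset[of ownless F] card_mono[of F ownless] by (auto simp: ownless_def)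
  have pascal: "n choose d = ((n - 1) choose d) + ((n - 1) choose (d - 1))"
    using False d_ge_2 choose_reduce_nat[of n d] by simp
  have "(n - 1) choose (d - 1) \<le> n choose (d - 1)"
    by (rule binomial_right_mono) simp
  also have "\<dots> \<le> n ^ (d - 1)"
    using card_layer_le[of "d - 1"] by (simp add: card_layer)
  finally have "(n - 1) choose (d - 1) \<le> n ^ (d - 1)" .
  moreover have "n ^ (d - 1) \<le> (d + 1) ^ 4 * n ^ (d - 1)"
    by simp
  ultimately show ?thesis
    using split own F pascal card_ownless_le double_card_owned_le assms by linarith
qed

end

section \<open>Typical sets and heavy extensions\<close>

locale threshold_family = traced_family +
  fixes K :: nat
  assumes K_pos: "1 \<le> K" and n_large: "2 * K ^ 2 + K + d \<le> n"
begin

definition bad_ext :: "'a set \<Rightarrow> 'a set" where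
  "bad_ext B = {z \<in> V - B. \<not> good (insert z B)}"

definition typical :: "'a set \<Rightarrow> bool" where
  "typical B \<longleftrightarrow> B \<in> layer (d - 1) \<and> card (bad_ext B) \<le> K"

definition ext :: "'a set \<Rightarrow> 'a set" where
  "ext A = {z \<in> V - A. insert z A \<in> F}"

text \<open>The threshold leaves more than \<open>K\<close> extensions once the at most
  \<open>K\<close> bad points of one typical set are removed, which is too many to be bad for a
  second typical set.\<close>

definition heavy :: "'a set \<Rightarrow> bool" where
  "heavy A \<longleftrightarrow> A \<in> layer d \<and> 2 * K + 1 \<le> card (ext A)"

lemma finite_bad_ext [simp]: "finite (bad_ext B)"
  by (simp add: bad_ext_def finite_V)

lemma finite_ext [simp]: "finite (ext B)"
  by (simp add: ext_def finite_V)

lemma typical_layer: "typical B \<Longrightarrow> B \<in> layer (d - 1)"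
  by (simp add: typical_def)

lemma insert_layer_d: "B \<in> layer (d - 1) \<Longrightarrow> z \<in> V - B \<Longrightarrow> insert z B \<in> layer d"
  using insert_layer[of B "d - 1" z] d_ge_2 by simp

text \<open>Double counting of the pairs \<open>(B, z)\<close> with \<open>z\<close> in
  \<open>bad_ext B\<close>: an atypical \<open>B\<close> has at least \<open>K + 1\<close> of them,
  and the injective map to \<open>(insert z B, z)\<close> uses each \<open>d\<close>-set that is not
  good at most \<open>d\<close> times.\<close>

lemma card_atypical_le:
  "(K + 1) * card {B \<in> layer (d - 1). \<not> typical B} \<le> d * card {A \<in> layer d. \<not> good A}"
proof -
  let ?S = "{B \<in> layer (d - 1). \<not> typical B}" and ?T = "{A \<in> layer d. \<not> good A}"
  have "(K + 1) * card ?S = (\<Sum>B\<in>?S. K + 1)" by simp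
  also have "\<dots> \<le> (\<Sum>B\<in>?S. card (bad_ext B))"
    by (intro sum_mono) (auto simp: typical_def)
  also have "\<dots> = card (Sigma ?S bad_ext)"
    by (intro card_SigmaI[symmetric]) auto
  also have "\<dots> \<le> card (Sigma ?T (\<lambda>A. A))"
  proof (rule card_inj_on_le)
    show "inj_on (\<lambda>(B, z). (insert z B, z)) (Sigma ?S bad_ext)"
      by (rule inj_on_inverseI[of _ "\<lambda>(A, z). (A - {z}, z)"]) (auto simp: bad_ext_def)
    show "(\<lambda>(B, z). (insert z B, z)) ` Sigma ?S bad_ext \<subseteq> Sigma ?T (\<lambda>A. A)"
      using insert_layer_d by (auto simp: bad_ext_def)
    show "finite (Sigma ?T (\<lambda>A. A))"
      using finite_layerD by (intro finite_SigmaI) auto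
  qed
  also have "\<dots> = (\<Sum>A\<in>?T. card A)"
    using finite_layerD by (intro card_SigmaI) auto
  also have "\<dots> = (\<Sum>A\<in>?T. d)"
    by (intro sum.cong) (auto simp: layer_def)
  finally show ?thesis by (simp add: mult.commute)
qed

text \<open>Trading \<open>z\<close> for the hub gives another \<open>d\<close>-subset of the same
  member, which is not own because \<open>insert z B\<close> is good. So for typical
  \<open>B\<close> the hubs of good extensions are among at most \<open>K\<close> points.\<close>

lemma hub_bad_ext:
  assumes B: "B \<in> layer (d - 1)" and z: "z \<in> V - B" and good: "good (insert z B)"
  shows "hub (insert z B) \<in> bad_ext B" "z \<in> ext (insert (hub (insert z B)) B)"
proof -
  let ?x = "hub (insert z B)"
  have x: "?x \<in> V - insert z B" "insert ?x (insert z B) \<in> F"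
    using hub[OF goodD[OF good]] .
  have "\<not> own (insert ?x (insert z B) - {z})"
    using good_not_own[OF good, of z] by simp
  moreover have "insert ?x (insert z B) - {z} = insert ?x B"
    using x z by auto
  ultimately show "?x \<in> bad_ext B"
    using x goodD by (auto simp: bad_ext_def)
  show "z \<in> ext (insert ?x B)"
    using x z by (auto simp: ext_def insert_commute)
qed

text \<open>Otherwise each of the at most \<open>K\<close> bad points is the hub of at most
  \<open>2 * K\<close> good extensions. Together with the bad points this covers at most
  \<open>2 * K ^ 2 + K\<close> points outside \<open>B\<close>, fewer than \<open>n_large\<close>
  provides.\<close>

lemma typical_has_heavy:
  assumes B: "typical B"
  shows "\<exists>x\<in>V - B. heavy (insert x B)"
proof (rule ccontr)
  assume none: "\<not> ?thesis"
  have BL: "B \<in> layer (d - 1)" using typical_layer[OF B] .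
  have small: "card (ext (insert x B)) \<le> 2 * K" if "x \<in> bad_ext B" for x
    using none that insert_layer_d[OF BL] by (auto simp: heavy_def bad_ext_def not_le less_Suc_eq_le)
  have "V - B \<subseteq> bad_ext B \<union> (\<Union>x\<in>bad_ext B. ext (insert x B))"
    using hub_bad_ext[OF BL] by (fastforce simp: bad_ext_def)
  then have "card (V - B) \<le> card (bad_ext B \<union> (\<Union>x\<in>bad_ext B. ext (insert x B)))"
    by (intro card_mono) auto
  also have "\<dots> \<le> card (bad_ext B) + card (\<Union>x\<in>bad_ext B. ext (insert x B))"
    by (rule card_Un_le)
  also have "card (\<Union>x\<in>bad_ext B. ext (insert x B)) \<le> (\<Sum>x\<in>bad_ext B. card (ext (insert x B)))"
    by (intro card_UN_le) simp
  also have "\<dots> \<le> card (bad_ext B) * (2 * K)"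
    using sum_bounded_above[of "bad_ext B" "\<lambda>x. card (ext (insert x B))" "2 * K"] small by simp
  also have "card (bad_ext B) + card (bad_ext B) * (2 * K) \<le> K + K * (2 * K)"
    using B by (intro add_mono mult_right_mono) (auto simp: typical_def)
  finally have "card (V - B) \<le> K + 2 * K ^ 2"
    by (simp add: power2_eq_square)
  moreover have "card (V - B) = n - (d - 1)"
    using BL finite_layerD[OF BL] by (simp add: layer_def card_Diff_subset)
  ultimately show False using n_large d_ge_2 by linarith
qed

text \<open>Suppose the points differ. For \<open>z\<close> in \<open>ext (insert x B)\<close> with
  \<open>insert z B\<close> good, the hub of \<open>insert z B\<close> is \<open>x\<close>, and
  \<open>insert z B'\<close> is another \<open>d\<close>-subset of the same member, hence not own.
  This makes more than \<open>K\<close> points \<open>z\<close> bad for \<open>B'\<close>.\<close>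

lemma heavy_inj:
  assumes B: "typical B" "typical B'" and x: "x \<in> V - B" "x' \<in> V - B'"
    and heavy: "heavy (insert x B)" and eq: "insert x B = insert x' B'"
  shows "x = x'"
proof (rule ccontr)
  assume ne: "x \<noteq> x'"
  have x'B: "x' \<in> B" using eq ne by auto
  have B': "B' = insert x B - {x'}" using eq x(2) by auto
  have "ext (insert x B) - bad_ext B \<subseteq> bad_ext B'"
  proof
    fix z assume z: "z \<in> ext (insert x B) - bad_ext B"
    then have zV: "z \<in> V - insert x B" "insert z (insert x B) \<in> F" and good: "good (insert z B)"
      by (auto simp: ext_def bad_ext_def)
    have "insert x (insert z B) \<in> F" using zV by (simp add: insert_commute)
    then have hub: "hub (insert z B) = x"
      using hub_unique[OF goodD[OF good], of x] zV x by blast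
    have "\<not> own (insert x (insert z B) - {x'})"
      using good_not_own[OF good, of x'] x'B hub by simp
    moreover have "insert x (insert z B) - {x'} = insert z B'"
      using zV x'B B' by auto
    ultimately show "z \<in> bad_ext B'"
      using zV B' goodD by (auto simp: bad_ext_def)
  qed
  then have "card (ext (insert x B) - bad_ext B) \<le> card (bad_ext B')"
    by (intro card_mono) auto
  moreover have "card (ext (insert x B)) - card (bad_ext B) \<le> card (ext (insert x B) - bad_ext B)"
    by (rule diff_card_le_card_Diff) simp
  moreover have "card (bad_ext B) \<le> K" "card (bad_ext B') \<le> K" "2 * K + 1 \<le> card (ext (insert x B))"
    using B heavy by (auto simp: typical_def heavy_def)
  ultimately show False by linarith
qed

text \<open>If \<open>x\<close> were not in \<open>X\<close>, each member
  \<open>insert z (insert x B)\<close> could meet \<open>X\<close> outside \<open>B\<close> only in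
  \<open>z\<close>. Then \<open>ext (insert x B)\<close> would lie in the two-point set
  \<open>X - B\<close>, too small for a heavy set.\<close>

lemma heavy_mem_traced:
  assumes X: "X \<in> traced B" and B: "B \<in> layer (d - 1)" and x: "x \<in> V - B" "heavy (insert x B)"
  shows "x \<in> X"
proof (rule ccontr)
  assume "x \<notin> X"
  have "ext (insert x B) \<subseteq> X - B"
  proof
    fix z assume "z \<in> ext (insert x B)"
    then have z: "z \<notin> insert x B" "insert z (insert x B) \<in> F" by (auto simp: ext_def)
    then show "z \<in> X - B"
      using tracedD(6)[OF X z(2)] \<open>x \<notin> X\<close> by blast
  qed
  then have "card (ext (insert x B)) \<le> card (X - B)"
    using finite_member[OF tracedD(2)[OF X]] by (intro card_mono) auto
  also have "\<dots> = 2"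
    using uniform[OF tracedD(2)[OF X]] B finite_layerD[OF B] tracedD(3)[OF X] d_ge_2
    by (simp add: card_Diff_subset layer_def)
  finally show False using x(2) K_pos by (simp add: heavy_def)
qed

section \<open>Sets with a single heavy point and the majority value\<close>

definition heavy_pt :: "'a set \<Rightarrow> 'a" where
  "heavy_pt B = (SOME x. x \<in> V - B \<and> heavy (insert x B))"

definition single :: "'a set \<Rightarrow> bool" where
  "single B \<longleftrightarrow> typical B \<and> (\<forall>x\<in>V - B. heavy (insert x B) \<longrightarrow> x = heavy_pt B)"

lemma heavy_pt: "typical B \<Longrightarrow> heavy_pt B \<in> V - B \<and> heavy (insert (heavy_pt B) B)"
  unfolding heavy_pt_def by (rule someI_ex) (use typical_has_heavy in blast)

text \<open>An exception is one of the at most \<open>K\<close> bad points, or a good extension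
  whose hub \<open>x\<close> is a bad point other than \<open>heavy_pt B\<close>. In the second case
  \<open>insert x B\<close> is not heavy, so \<open>x\<close> serves at most \<open>2 * K\<close>
  extensions.\<close>

lemma card_light_ext_le:
  assumes B: "single B"
  shows "card {z \<in> V - B. \<not> (good (insert z B) \<and> hub (insert z B) = heavy_pt B)} \<le> 2 * K ^ 2 + K"
proof -
  have tB: "typical B" using B by (simp add: single_def)
  have BL: "B \<in> layer (d - 1)" using typical_layer[OF tB] .
  let ?M = "bad_ext B - {heavy_pt B}"
  have small: "card (ext (insert x B)) \<le> 2 * K" if "x \<in> ?M" for x
    using B that insert_layer_d[OF BL] by (auto simp: heavy_def bad_ext_def not_le single_def less_Suc_eq_le)
  have "{z \<in> V - B. \<not> (good (insert z B) \<and> hub (insert z B) = heavy_pt B)}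
      \<subseteq> bad_ext B \<union> (\<Union>x\<in>?M. ext (insert x B))"
  proof
    fix z assume "z \<in> {z \<in> V - B. \<not> (good (insert z B) \<and> hub (insert z B) = heavy_pt B)}"
    then show "z \<in> bad_ext B \<union> (\<Union>x\<in>?M. ext (insert x B))"
      using hub_bad_ext[OF BL, of z] by (cases "good (insert z B)") (auto simp: bad_ext_def)
  qed
  then have "card {z \<in> V - B. \<not> (good (insert z B) \<and> hub (insert z B) = heavy_pt B)}
      \<le> card (bad_ext B \<union> (\<Union>x\<in>?M. ext (insert x B)))"
    by (intro card_mono) auto
  also have "\<dots> \<le> card (bad_ext B) + card (\<Union>x\<in>?M. ext (insert x B))"
    by (rule card_Un_le)
  also have "card (\<Union>x\<in>?M. ext (insert x B)) \<le> (\<Sum>x\<in>?M. card (ext (insert x B)))"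
    by (intro card_UN_le) simp
  also have "\<dots> \<le> card ?M * (2 * K)"
    using sum_bounded_above[of ?M "\<lambda>x. card (ext (insert x B))" "2 * K"] small by simp
  also have "card (bad_ext B) + card ?M * (2 * K) \<le> K + K * (2 * K)"
  proof (intro add_mono mult_right_mono)
    show "card (bad_ext B) \<le> K" using tB by (simp add: typical_def)
    then show "card ?M \<le> K"
      using card_mono[of "bad_ext B" ?M] by fastforce
  qed auto
  finally show ?thesis
    by (simp add: power2_eq_square)
qed

definition main_pt :: "'a set \<Rightarrow> 'a" where
  "main_pt C = (SOME v. card {b \<in> V - C. single (insert b C) \<and> heavy_pt (insert b C) \<noteq> v}
      \<le> 2 * (2 * K ^ 2 + K))"

text \<open>In \<open>majority_colour\<close> an arc runs from \<open>b\<close> to \<open>z\<close>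
  unless adding \<open>z\<close> to \<open>insert b C\<close> gives a good set with hub
  \<open>heavy_pt (insert b C)\<close>. If no arc joins \<open>b\<close> and \<open>z\<close>, the
  same set \<open>insert z (insert b C)\<close> has both heavy points as its hub, so they
  agree.\<close>

lemma main_pt:
  "card {b \<in> V - C. single (insert b C) \<and> heavy_pt (insert b C) \<noteq> main_pt C} \<le> 2 * (2 * K ^ 2 + K)"
proof -
  let ?Y = "{b \<in> V - C. single (insert b C)}"
  let ?R = "\<lambda>b z. z \<noteq> b \<and> \<not> (good (insert z (insert b C)) \<and> hub (insert z (insert b C)) = heavy_pt (insert b C))"
  have "\<exists>v. card {b \<in> ?Y. heavy_pt (insert b C) \<noteq> v} \<le> 2 * (2 * K ^ 2 + K)"
  proof (rule majority_colour[where R = ?R])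
    show "finite ?Y" using finite_V by simp
  next
    fix b assume b: "b \<in> ?Y"
    have "card {z \<in> ?Y. ?R b z} \<le> card {z \<in> V - insert b C.
        \<not> (good (insert z (insert b C)) \<and> hub (insert z (insert b C)) = heavy_pt (insert b C))}"
      using finite_V by (intro card_mono) auto
    also have "\<dots> \<le> 2 * K ^ 2 + K"
      using b by (intro card_light_ext_le) simp
    finally show "card {z \<in> ?Y. ?R b z} \<le> 2 * K ^ 2 + K" .
  next
    fix b z assume "b \<in> ?Y" "z \<in> ?Y" "heavy_pt (insert b C) \<noteq> heavy_pt (insert z C)"
    then show "?R b z \<or> ?R z b"
      by (metis insert_commute)
  qed
  then have "\<exists>v. card {b \<in> V - C. single (insert b C) \<and> heavy_pt (insert b C) \<noteq> v} \<le> 2 * (2 * K ^ 2 + K)"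
    by (simp add: conj_assoc)
  from someI_ex[OF this] show ?thesis unfolding main_pt_def .
qed

text \<open>For a single set outside \<open>minority\<close>, the heavy point can be read off from
  the set with any one point deleted; \<open>card_traced_majority_le\<close> relies on this.\<close>

definition minority :: "'a set set" where
  "minority = {B. single B \<and> (\<exists>b\<in>B. heavy_pt B \<noteq> main_pt (B - {b}))}"

lemma minority_layer: "minority \<subseteq> layer (d - 1)"
  using typical_layer by (auto simp: minority_def single_def)

lemma card_minority_le: "card minority \<le> 2 * (2 * K ^ 2 + K) * n ^ (d - 2)"
proof -
  let ?Z = "\<lambda>C. {b \<in> V - C. single (insert b C) \<and> heavy_pt (insert b C) \<noteq> main_pt C}"
  have "minority \<subseteq> (\<Union>C\<in>layer (d - 2). (\<lambda>b. insert b C) ` ?Z C)"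
  proof
    fix B assume B: "B \<in> minority"
    then obtain b where b: "b \<in> B" "heavy_pt B \<noteq> main_pt (B - {b})" and s: "single B"
      by (auto simp: minority_def)
    have BL: "B \<in> layer (Suc (d - 2))"
      using B minority_layer d_ge_2 by (auto simp: Suc_diff_Suc numeral_2_eq_2)
    have "B - {b} \<in> layer (d - 2)" using remove_layer[OF BL b(1)] .
    moreover have "b \<in> ?Z (B - {b})"
      using b s BL by (auto simp: insert_absorb layer_def)
    moreover have "B = insert b (B - {b})" using b by auto
    ultimately show "B \<in> (\<Union>C\<in>layer (d - 2). (\<lambda>b. insert b C) ` ?Z C)"
      by blast
  qed
  then have "card minority \<le> card (\<Union>C\<in>layer (d - 2). (\<lambda>b. insert b C) ` ?Z C)"
    using finite_V by (intro card_mono) auto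
  also have "\<dots> \<le> (\<Sum>C\<in>layer (d - 2). card ((\<lambda>b. insert b C) ` ?Z C))"
    by (intro card_UN_le) simp
  also have "\<dots> \<le> (\<Sum>C\<in>layer (d - 2). 2 * (2 * K ^ 2 + K))"
  proof (rule sum_mono)
    fix C
    have "card ((\<lambda>b. insert b C) ` ?Z C) \<le> card (?Z C)"
      using finite_V by (intro card_image_le) auto
    then show "card ((\<lambda>b. insert b C) ` ?Z C) \<le> 2 * (2 * K ^ 2 + K)"
      using main_pt[of C] by linarith
  qed
  also have "\<dots> = card (layer (d - 2)) * (2 * (2 * K ^ 2 + K))" by simp
  also have "\<dots> \<le> n ^ (d - 2) * (2 * (2 * K ^ 2 + K))"
    using card_layer_le by (rule mult_right_mono) simp
  finally show ?thesis by (simp add: mult.commute)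
qed

section \<open>Charging ownless members to sets that are not own\<close>

definition heavy_sets :: "'a set set" where
  "heavy_sets = {A. heavy A \<and> (\<exists>B. typical B \<and> B \<subseteq> A)}"

definition light_sets :: "'a set set" where
  "light_sets = {A \<in> layer d. \<not> own A \<and> \<not> heavy A}"

text \<open>An own set has no extension but its hub, while a heavy set has at least three. Hence the
  three families of \<open>d\<close>-sets are disjoint.\<close>

lemma card_heavy_light_le:
  "card heavy_sets + card light_sets + card (Collect own) \<le> n choose d"
proof -
  have heavy: "\<not> own A" if "heavy A" for A
  proof
    assume own: "own A"
    have "ext A \<subseteq> {hub A}"
      using hub_unique[OF own] by (auto simp: ext_def)
    then have "card (ext A) \<le> 1"
      using card_mono[of "{hub A}" "ext A"] by simp
    then show False using that K_pos by (simp add: heavy_def)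
  qed
  have "heavy_sets \<subseteq> layer d" "light_sets \<subseteq> layer d" "Collect own \<subseteq> layer d"
    using own_layer by (auto simp: heavy_sets_def light_sets_def heavy_def)
  then have sub: "heavy_sets \<union> light_sets \<union> Collect own \<subseteq> layer d"
    and fin: "finite heavy_sets" "finite light_sets"
    using finite_layer finite_subset by blast+
  have "card (heavy_sets \<union> light_sets \<union> Collect own) = card (heavy_sets \<union> light_sets) + card (Collect own)"
    using fin heavy by (intro card_Un_disjoint) (auto simp: heavy_sets_def light_sets_def)
  also have "card (heavy_sets \<union> light_sets) = card heavy_sets + card light_sets"
    using fin by (intro card_Un_disjoint) (auto simp: heavy_sets_def light_sets_def)
  finally show ?thesis
    using card_mono[OF finite_layer sub] by (simp add: card_layer)
qed

text \<open>Each typical \<open>B\<close> yields the heavy set \<open>insert (heavy_pt B) B\<close>,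
  and a second one if it is not single. By \<open>heavy_inj\<close> a heavy set determines its
  typical subset and the added point, so none is obtained twice.\<close>

lemma card_heavy_sets_ge:
  "card (Collect typical) + card {B. typical B \<and> \<not> single B} \<le> card heavy_sets"
proof -
  let ?T = "Collect typical" and ?D = "{B. typical B \<and> \<not> single B}"
  have "\<exists>y. \<forall>B\<in>?D. y B \<in> V - B \<and> heavy (insert (y B) B) \<and> y B \<noteq> heavy_pt B"
    by (intro bchoice) (auto simp: single_def)
  then obtain y where y: "\<And>B. B \<in> ?D \<Longrightarrow> y B \<in> V - B \<and> heavy (insert (y B) B) \<and> y B \<noteq> heavy_pt B"
    by blast
  have eqD: "B = B'"
    if "typical B" "typical B'" "x \<in> V - B" "x' \<in> V - B'" "heavy (insert x B)"
      "insert x B = insert x' B'" for B B' x x'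
    using heavy_inj[OF that] that(3,4,6) by (metis DiffD2 insert_ident)
  have finT: "finite ?T" using typical_layer by (auto intro: finite_subset[OF _ finite_layer[of "d - 1"]])
  have finD: "finite ?D" by (rule finite_subset[OF _ finT]) auto
  have f: "inj_on (\<lambda>B. insert (heavy_pt B) B) ?T"
  proof (rule inj_onI)
    fix B B' assume B: "B \<in> ?T" "B' \<in> ?T" "insert (heavy_pt B) B = insert (heavy_pt B') B'"
    then show "B = B'" using eqD heavy_pt by (metis mem_Collect_eq)
  qed
  have g: "inj_on (\<lambda>B. insert (y B) B) ?D"
  proof (rule inj_onI)
    fix B B' assume B: "B \<in> ?D" "B' \<in> ?D" "insert (y B) B = insert (y B') B'"
    then show "B = B'" using eqD y[OF B(1)] y[OF B(2)] by blast
  qed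
  have disj: "(\<lambda>B. insert (heavy_pt B) B) ` ?T \<inter> (\<lambda>B. insert (y B) B) ` ?D = {}"
  proof (rule ccontr)
    assume "\<not> ?thesis"
    then obtain B B' where B: "typical B" "B' \<in> ?D" and eq: "insert (heavy_pt B) B = insert (y B') B'"
      by blast
    have B': "typical B'" using B by simp
    have h: "heavy_pt B \<in> V - B" "heavy (insert (heavy_pt B) B)" using heavy_pt[OF B(1)] by auto
    have h': "y B' \<in> V - B'" "y B' \<noteq> heavy_pt B'" using y[OF B(2)] by auto
    have "heavy_pt B = y B'" using heavy_inj[OF B(1) B' h(1) h'(1) h(2) eq] .
    moreover have "B = B'" using eqD[OF B(1) B' h(1) h'(1) h(2) eq] .
    ultimately show False using h'(2) by simp
  qed
  have "card ?T + card ?D = card ((\<lambda>B. insert (heavy_pt B) B) ` ?T) + card ((\<lambda>B. insert (y B) B) ` ?D)"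
    using card_image[OF f] card_image[OF g] by simp
  also have "\<dots> = card ((\<lambda>B. insert (heavy_pt B) B) ` ?T \<union> (\<lambda>B. insert (y B) B) ` ?D)"
    using finT finD disj by (intro card_Un_disjoint[symmetric]) auto
  also have "\<dots> \<le> card heavy_sets"
  proof (rule card_mono)
    have "heavy_sets \<subseteq> layer d" by (auto simp: heavy_sets_def heavy_def)
    then show "finite heavy_sets" using finite_layer finite_subset by blast
    show "(\<lambda>B. insert (heavy_pt B) B) ` ?T \<union> (\<lambda>B. insert (y B) B) ` ?D \<subseteq> heavy_sets"
      using heavy_pt y by (auto simp: heavy_sets_def)
  qed
  finally show ?thesis .
qed

text \<open>A member traced by \<open>B\<close> contains two heavy points besides the
  \<open>d - 1\<close> points of \<open>B\<close>, and this is all of it.\<close>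

lemma card_traced_multiple_le:
  assumes B: "typical B" "\<not> single B"
  shows "card (traced B) \<le> 1"
proof -
  have BL: "B \<in> layer (d - 1)" using typical_layer[OF B(1)] .
  obtain x where x: "x \<in> V - B" "heavy (insert x B)" "x \<noteq> heavy_pt B"
    using B by (auto simp: single_def)
  have h: "heavy_pt B \<in> V - B" "heavy (insert (heavy_pt B) B)"
    using heavy_pt[OF B(1)] by auto
  have "traced B \<subseteq> {insert x (insert (heavy_pt B) B)}"
  proof
    fix X assume X: "X \<in> traced B"
    have "x \<in> X" "heavy_pt B \<in> X" "B \<subseteq> X"
      using heavy_mem_traced[OF X BL] x h tracedD(3)[OF X] by auto
    then have "insert x (insert (heavy_pt B) B) \<subseteq> X" by simp
    moreover have "insert x (insert (heavy_pt B) B) \<in> layer (Suc d)"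
      using insert_layer[OF insert_layer_d[OF BL h(1)], of x] x by auto
    ultimately have "insert x (insert (heavy_pt B) B) = X"
      using uniform[OF tracedD(2)[OF X]] finite_member[OF tracedD(2)[OF X]]
      by (intro card_subset_eq) (auto simp: layer_def)
    then show "X \<in> {insert x (insert (heavy_pt B) B)}" by simp
  qed
  then show ?thesis
    using card_mono[of "{insert x (insert (heavy_pt B) B)}" "traced B"] by simp
qed

text \<open>Delete from each member the heavy point of its trace. The remaining \<open>d\<close>-set
  is not own as the member is ownless, and not heavy as the only heavy point of the trace is gone.
  Injectivity holds because the deleted point can be recovered.\<close>

lemma card_traced_majority_le:
  "card (\<Union>B\<in>{B. single B} - minority. traced B) \<le> card light_sets"
proof (rule card_inj_on_le)
  let ?U = "\<Union>B\<in>{B. single B} - minority. traced B"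
  let ?f = "\<lambda>X. X - {heavy_pt (trace X)}"
  have U: "single (trace X)" "trace X \<notin> minority" "X \<in> traced (trace X)" if "X \<in> ?U" for X
    using that by (auto simp: traced_def)
  have BL: "trace X \<in> layer (d - 1)" if "X \<in> ?U" for X
    using U(1)[OF that] by (simp add: single_def typical_def)
  have h: "heavy_pt (trace X) \<in> V - trace X" "heavy (insert (heavy_pt (trace X)) (trace X))"
    if "X \<in> ?U" for X
    using heavy_pt U(1)[OF that] by (auto simp: single_def)
  have hX: "heavy_pt (trace X) \<in> X" if "X \<in> ?U" for X
    using heavy_mem_traced[OF U(3) BL h] that by blast
  have fX: "?f X \<in> layer d" "trace X \<subseteq> ?f X" if "X \<in> ?U" for X
  proof -
    show "?f X \<in> layer d"
      using remove_layer[OF member_layer[OF tracedD(2)[OF U(3)]] hX] that by blast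
    show "trace X \<subseteq> ?f X"
      using tracedD(3)[OF U(3)[OF that]] h(1)[OF that] by blast
  qed
  obtain y where y: "\<And>X. X \<in> ?U \<Longrightarrow> y X \<in> V - trace X \<and> ?f X = insert (y X) (trace X)"
  proof -
    have "\<exists>y. y \<in> V - trace X \<and> ?f X = insert y (trace X)" if "X \<in> ?U" for X
      using layer_superset_eq_insert[OF BL[OF that] _ fX(2)[OF that]] fX(1)[OF that] d_ge_2 by auto
    then have "\<exists>y. \<forall>X\<in>?U. y X \<in> V - trace X \<and> ?f X = insert (y X) (trace X)"
      by (intro bchoice) blast
    then show ?thesis using that by blast
  qed
  show "?f ` ?U \<subseteq> light_sets"
  proof (rule image_subsetI)
    fix X assume X: "X \<in> ?U"
    have "\<not> own (?f X)"
      using tracedD(1)[OF U(3)[OF X]] by (auto simp: ownless_def)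
    moreover have "\<not> heavy (?f X)"
    proof
      assume "heavy (?f X)"
      then have "y X = heavy_pt (trace X)"
        using y[OF X] U(1)[OF X] by (simp add: single_def)
      then show False using y[OF X] by blast
    qed
    ultimately show "?f X \<in> light_sets"
      using fX(1)[OF X] by (simp add: light_sets_def)
  qed
  show "inj_on ?f ?U"
  proof (rule inj_onI)
    fix X X' assume X: "X \<in> ?U" "X' \<in> ?U" and eq: "?f X = ?f X'"
    have "heavy_pt (trace X) = heavy_pt (trace X')"
    proof (cases "trace X = trace X'")
      case False
      \<comment> \<open>Two distinct traces inside one \<open>d\<close>-set share
        \<open>d - 2\<close> points. Neither is in \<open>minority\<close>, so both heavy points
        equal \<open>main_pt\<close> of the common part.\<close>
      define B B' where "B = trace X" and "B' = trace X'"
      have ins: "insert (y X) B = insert (y X') B'"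
        using y X eq by (metis B_def B'_def)
      have ny: "y X \<notin> B" "y X' \<notin> B'" using y X by (auto simp: B_def B'_def)
      have ne: "y X \<noteq> y X'"
        using ins ny False by (metis B_def B'_def insert_ident)
      have mem: "y X' \<in> B" "y X \<in> B'" using ins ne by (metis insertE insertI1)+
      have "B - {y X'} = insert (y X) B - {y X, y X'}" "B' - {y X} = insert (y X') B' - {y X, y X'}"
        using ny by auto
      then have "B - {y X'} = B' - {y X}" using ins by simp
      moreover have "heavy_pt B = main_pt (B - {y X'})"
        using U(1,2)[OF X(1)] mem by (auto simp: minority_def B_def)
      moreover have "heavy_pt B' = main_pt (B' - {y X})"
        using U(1,2)[OF X(2)] mem by (auto simp: minority_def B'_def)
      ultimately show ?thesis by (simp add: B_def B'_def)
    qed simp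
    then show "X = X'"
      using eq hX X by (metis insert_Diff)
  qed
  have "light_sets \<subseteq> layer d" by (auto simp: light_sets_def)
  then show "finite light_sets" using finite_layer finite_subset by blast
qed

section \<open>Combining the counts\<close>

text \<open>\<open>card F\<close> is at most the number of own sets plus
  \<open>card ownless\<close>. In the bound for \<open>ownless\<close> the terms for typical sets
  that are not single and for \<open>light_sets\<close> cancel against \<open>d\<close>-sets that
  are not own. The typical sets supply \<open>n choose (d - 1)\<close> up to the atypical ones,
  whence the extra \<open>1\<close> in the coefficient of the latter.\<close>

lemma card_bound_aux:
  "card F + (n choose (d - 1)) \<le> (n choose d) + d * (d + 1) ^ 3 * n ^ (d - 2)
    + ((d + 1) ^ 2 + 1) * card {B \<in> layer (d - 1). \<not> typical B} + (d + 1) ^ 2 * card minority"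
proof -
  let ?T = "Collect typical" and ?A = "{B \<in> layer (d - 1). \<not> typical B}"
    and ?D = "{B. typical B \<and> \<not> single B}" and ?S = "{B. single B} - minority"
    and ?s = "{X \<in> ownless. card (trace X) \<le> d - 2}"
  let ?u = "\<lambda>S. \<Union>B\<in>S. traced B"
  have TL: "?T \<subseteq> layer (d - 1)" using typical_layer by blast
  have "layer (d - 1) = ?T \<union> ?A" using TL by blast
  moreover have "finite ?T" using TL finite_layer finite_subset by blast
  ultimately have layer: "n choose (d - 1) = card ?T + card ?A"
    using card_Un_disjoint[of ?T ?A] by (fastforce simp flip: card_layer)
  have F: "card F = card (F - ownless) + card ownless"
    using card_Diff_subset[of ownless F] card_mono[of F ownless] by (auto simp: ownless_def)
  have "layer (d - 1) \<subseteq> ?A \<union> (?D \<union> (minority \<union> ?S))"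
    by auto
  then have "?u (layer (d - 1)) \<subseteq> ?u (?A \<union> (?D \<union> (minority \<union> ?S)))"
    by (rule UN_mono) simp
  then have "?u (layer (d - 1)) \<subseteq> ?u ?A \<union> (?u ?D \<union> (?u minority \<union> ?u ?S))"
    by (simp only: UN_Un)
  then have "?s \<union> ?u (layer (d - 1)) \<subseteq> ?s \<union> (?u ?A \<union> (?u ?D \<union> (?u minority \<union> ?u ?S)))"
    by (rule Un_mono[OF order.refl])
  then have "ownless \<subseteq> ?s \<union> (?u ?A \<union> (?u ?D \<union> (?u minority \<union> ?u ?S)))"
    by (rule order.trans[OF equalityD1[OF ownless_split]])
  moreover have "finite (?s \<union> (?u ?A \<union> (?u ?D \<union> (?u minority \<union> ?u ?S))))"
    by (rule finite_subset[OF _ finite_ownless]) (auto simp: traced_def)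
  ultimately have "card ownless \<le> card (?s \<union> (?u ?A \<union> (?u ?D \<union> (?u minority \<union> ?u ?S))))"
    by (rule card_mono[rotated])
  also have "\<dots> \<le> card ?s + (card (?u ?A) + (card (?u ?D) + (card (?u minority) + card (?u ?S))))"
    by (intro order.trans[OF card_Un_le] add_mono order.refl)
  also have "\<dots> \<le> d * (d + 1) ^ 3 * n ^ (d - 2) + ((d + 1) ^ 2 * card ?A + (card ?D
      + ((d + 1) ^ 2 * card minority + card light_sets)))"
  proof (intro add_mono)
    show "card (?u ?A) \<le> (d + 1) ^ 2 * card ?A"
      by (rule card_traced_Union_le) auto
    show "card (?u minority) \<le> (d + 1) ^ 2 * card minority"
      by (rule card_traced_Union_le[OF minority_layer])
    have finD: "finite ?D"
      by (rule finite_subset[OF _ finite_layer[of "d - 1"]]) (auto dest: typical_layer)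
    have "card (?u ?D) \<le> (\<Sum>B\<in>?D. card (traced B))"
      by (rule card_UN_le[OF finD])
    also have "\<dots> \<le> (\<Sum>B\<in>?D. 1)"
      using card_traced_multiple_le by (intro sum_mono) auto
    finally show "card (?u ?D) \<le> card ?D" by simp
  qed (use card_small_trace_le card_traced_majority_le in auto)
  finally have "card ownless \<le> \<dots>" .
  moreover have "((d + 1) ^ 2 + 1) * card ?A = (d + 1) ^ 2 * card ?A + card ?A"
    by simp
  ultimately show ?thesis
    using F layer card_owned_le card_heavy_light_le card_heavy_sets_ge by linarith
qed


text \<open>Multiplying by \<open>K\<close> avoids a division in the natural numbers. The products
  of \<open>n ^ (d - 2)\<close> with \<open>K\<close> and \<open>K ^ 3\<close> are absorbed into
  \<open>n ^ (d - 1)\<close> by \<open>K \<le> n\<close> and \<open>K ^ 3 \<le> n\<close>.\<close>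

lemma card_bound:
  assumes F: "(n - 1) choose d \<le> card F" and K: "K ^ 3 \<le> n"
  shows "K * card F \<le> K * ((n - 1) choose d) + 20 * (d + 1) ^ 7 * n ^ (d - 1)"
proof -
  let ?q = "d + 1" and ?N = "n ^ (d - 1)"
  let ?A = "card {B \<in> layer (d - 1). \<not> typical B}"
  have n_pos: "0 < n" using n_large d_ge_2 by linarith
  have n_power: "n ^ (d - 2) * n = ?N"
    using d_ge_2 power_Suc2[of n "d - 2"] by (simp add: Suc_diff_Suc numeral_2_eq_2)
  have K_le: "K \<le> n" "K ^ 2 \<le> K ^ 3" "K \<le> K ^ 3"
    using n_large K_pos by (auto intro: power_increasing self_le_power)
  have q: "?q ^ i \<le> ?q ^ 7" if "i \<le> 7" for i
    using that by (intro power_increasing) auto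
  have "n choose d = ((n - 1) choose d) + ((n - 1) choose (d - 1))"
    using n_pos d_ge_2 choose_reduce_nat[of n d] by simp
  moreover have "(n - 1) choose (d - 1) \<le> n choose (d - 1)"
    by (rule binomial_right_mono) simp
  ultimately have "card F \<le> ((n - 1) choose d) + d * ?q ^ 3 * n ^ (d - 2)
      + (?q ^ 2 + 1) * ?A + ?q ^ 2 * card minority"
    using card_bound_aux by linarith
  then have "K * card F \<le> K * (((n - 1) choose d) + d * ?q ^ 3 * n ^ (d - 2)
      + (?q ^ 2 + 1) * ?A + ?q ^ 2 * card minority)"
    by (rule mult_left_mono) simp
  also have "\<dots> = K * ((n - 1) choose d) + d * ?q ^ 3 * (n ^ (d - 2) * K)
      + (?q ^ 2 + 1) * (K * ?A) + ?q ^ 2 * (K * card minority)"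
    by (simp only: distrib_left mult_ac)
  also have "d * ?q ^ 3 * (n ^ (d - 2) * K) \<le> ?q ^ 7 * ?N"
  proof (rule mult_mono)
    have "d * ?q ^ 3 \<le> ?q * ?q ^ 3" by (rule mult_right_mono) auto
    also have "\<dots> = ?q ^ 4" by (simp add: eval_nat_numeral)
    finally show "d * ?q ^ 3 \<le> ?q ^ 7" using q[of 4] by linarith
    have "n ^ (d - 2) * K \<le> n ^ (d - 2) * n" using K_le(1) by (rule mult_left_mono) simp
    then show "n ^ (d - 2) * K \<le> ?N" unfolding n_power .
  qed auto
  also have "(?q ^ 2 + 1) * (K * ?A) \<le> (2 * ?q ^ 2) * (6 * ?q ^ 5 * ?N)"
  proof (rule mult_mono)
    show "?q ^ 2 + 1 \<le> 2 * ?q ^ 2" using one_le_power[of ?q 2] by simp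
    have "K * ?A \<le> (K + 1) * ?A" by simp
    also have "\<dots> \<le> d * card {A \<in> layer d. \<not> good A}" by (rule card_atypical_le)
    also have "\<dots> \<le> ?q * (6 * ?q ^ 4 * ?N)"
      using card_not_good_le[OF F] by (intro mult_mono) auto
    also have "\<dots> = 6 * (?q * ?q ^ 4) * ?N" by (simp only: mult_ac)
    also have "?q * ?q ^ 4 = ?q ^ 5" by (simp add: eval_nat_numeral)
    finally show "K * ?A \<le> 6 * ?q ^ 5 * ?N" .
  qed auto
  also have "(2 * ?q ^ 2) * (6 * ?q ^ 5 * ?N) = 12 * (?q ^ 2 * ?q ^ 5) * ?N"
    by (simp only: mult_ac)
  also have "?q ^ 2 * ?q ^ 5 = ?q ^ 7" by (simp only: power_add[symmetric]) simp
  also have "?q ^ 2 * (K * card minority) \<le> ?q ^ 7 * (6 * ?N)"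
  proof (rule mult_mono)
    have "K * card minority \<le> K * (2 * (2 * K ^ 2 + K) * n ^ (d - 2))"
      using card_minority_le by (rule mult_left_mono) simp
    also have "\<dots> = (4 * K ^ 3 + 2 * K ^ 2) * n ^ (d - 2)"
      by (simp add: algebra_simps power2_eq_square power3_eq_cube)
    also have "\<dots> \<le> (6 * n) * n ^ (d - 2)"
      using K K_le by (intro mult_right_mono) auto
    also have "\<dots> = 6 * ?N" using n_power by (simp add: mult.commute mult.left_commute)
    finally show "K * card minority \<le> 6 * ?N" .
  qed (use q[of 2] in auto)
  finally have "K * card F \<le> K * ((n - 1) choose d) + ?q ^ 7 * ?N + 12 * ?q ^ 7 * ?N + ?q ^ 7 * (6 * ?N)"
    by linarith
  \<comment> \<open>Small traces contribute \<open>1\<close>, atypical sets \<open>12\<close> and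
    minority sets \<open>6\<close>.\<close>
  also have "\<dots> = K * ((n - 1) choose d) + 19 * (?q ^ 7 * ?N)"
    by simp
  finally show ?thesis by (simp only: mult.assoc)
qed

end

section \<open>Choice of the threshold\<close>

lemma nat_cube_root:
  fixes n :: nat
  assumes "1 \<le> n"
  obtains K :: nat where "1 \<le> K" "K ^ 3 \<le> n" "n < (K + 1) ^ 3" "real n powr (1 / 3) \<le> 2 * real K"
proof -
  define r where "r = root 3 (real n)"
  define K where "K = nat \<lfloor>r\<rfloor>"
  have r: "1 \<le> r" "r ^ 3 = real n" using assms by (auto simp: r_def)
  have K: "real K \<le> r" "r < real K + 1" "1 \<le> K"
    using r(1) unfolding K_def by linarith+
  show ?thesis
  proof (rule that[of K])
    have "real K ^ 3 \<le> r ^ 3" using K by (intro power_mono) auto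
    then show "K ^ 3 \<le> n" unfolding r(2) by (simp flip: of_nat_power)
    have "r ^ 3 < (real K + 1) ^ 3" using K r by (intro power_strict_mono) auto
    then have "real n < real ((K + 1) ^ 3)" unfolding r(2) by (simp add: add.commute)
    then show "n < (K + 1) ^ 3" by (simp only: of_nat_less_iff)
    have "real n powr (1 / 3) = r"
      using assms by (simp add: r_def root_powr_inverse)
    then show "real n powr (1 / 3) \<le> 2 * real K" using K by linarith
  qed (rule K(3))
qed

theorem theorem1p3:
  fixes d :: nat
  assumes "d \<ge> 2"
  shows "\<exists>C::real. C > 0 \<and> (\<exists>n0::nat. \<forall>n\<ge>n0. \<forall>F.
           F \<subseteq> {X. X \<subseteq> {1..n} \<and> card X = d + 1} \<and> vc_dim_le n F d \<longrightarrow>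
           real (card F) \<le> real ((n - 1) choose d) + C * real n powr (real d - 1 - 1 / (4 * real d - 2)))"
proof -
  define c where "c = 20 * (d + 1) ^ 7"
  \<comment> \<open>The factor \<open>2\<close> pays for rounding the cube root of \<open>n\<close>
    down to \<open>K\<close>. The summand \<open>64 = 4 ^ 3\<close> forces \<open>4 \<le> K\<close>,
    so \<open>2 * K ^ 2 + K \<le> 3 * K ^ 2\<close> is at most three quarters of \<open>n\<close>,
    and \<open>4 * d\<close> leaves the last quarter for \<open>d\<close>.\<close>
  have "real (card F) \<le> real ((n - 1) choose d) + 2 * real c * real n powr (real d - 1 - 1 / (4 * real d - 2))"
    if n: "n \<ge> 64 + 4 * d" and F: "F \<subseteq> {X. X \<subseteq> {1..n} \<and> card X = d + 1}" and vc: "vc_dim_le n F d"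
    for n F
  proof (cases "(n - 1) choose d \<le> card F")
    case False
    then show ?thesis by (simp add: add_increasing2)
  next
    case True
    obtain K where K: "1 \<le> K" "K ^ 3 \<le> n" "n < (K + 1) ^ 3" "real n powr (1 / 3) \<le> 2 * real K"
      using nat_cube_root[of n] n by auto
    have "4 \<le> K"
    proof (rule ccontr)
      assume "\<not> 4 \<le> K"
      then have "(K + 1) ^ 3 \<le> 4 ^ 3" by (intro power_mono) auto
      then show False using K(3) n by simp
    qed
    then have "4 * K ^ 2 \<le> K ^ 3"
      by (simp add: power2_eq_square power3_eq_cube)
    moreover have "K \<le> K ^ 2" using K(1) by (intro self_le_power) auto
    ultimately have large: "2 * K ^ 2 + K + d \<le> n" using K(2) n by linarith
    interpret threshold_family "{1..n}" F d K
    proof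
      show "\<exists>B\<subseteq>X. \<forall>Y\<in>F. Y \<inter> X \<noteq> B" if "X \<in> F" for X
      proof -
        have "X \<subseteq> {1..n}" "card X = d + 1" using that F by auto
        then have "\<not> shatters F X" using vc by (auto simp: vc_dim_le_def)
        then show ?thesis by (auto simp: shatters_def)
      qed
    qed (use assms F K large in auto)
    have "K * card F \<le> K * ((n - 1) choose d) + c * n ^ (d - 1)"
      using card_bound True K(2) by (simp add: c_def)
    then have "real (K * card F) \<le> real (K * ((n - 1) choose d) + c * n ^ (d - 1))"
      by (simp only: of_nat_le_iff)
    then have "real (card F) \<le> real ((n - 1) choose d) + real c * (real n ^ (d - 1) / real K)"
      using K(1) by (simp add: field_simps)
    also have "real n ^ (d - 1) / real K \<le> 2 * real n powr (real d - 1 - 1 / (4 * real d - 2))"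
    proof -
      have "real n ^ (d - 1) / real K \<le> real n ^ (d - 1) / (real n powr (1 / 3) / 2)"
        using K(1,4) n by (intro divide_left_mono) auto
      also have "\<dots> = 2 * real n powr (real d - 1 - 1 / 3)"
      proof -
        have "real n ^ (d - 1) = real n powr (real d - 1)"
          using n assms powr_realpow[of "real n" "d - 1"] by (simp add: of_nat_diff)
        then show ?thesis using powr_diff[of "real n" "real d - 1" "1 / 3"] by simp
      qed
      also have "\<dots> \<le> 2 * real n powr (real d - 1 - 1 / (4 * real d - 2))"
      proof -
        \<comment> \<open>As \<open>4 * d - 2\<close> is at least \<open>6\<close>, the saving
          \<open>1 / 3\<close> in the exponent is larger than the one claimed.\<close>
        have "1 / (4 * real d - 2) \<le> 1 / 3"
          using assms by (intro divide_left_mono) auto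
        then show ?thesis using n by (intro mult_left_mono powr_mono) auto
      qed
      finally show ?thesis .
    qed
    finally show ?thesis by (simp add: mult_left_mono mult.assoc mult.left_commute)
  qed
  moreover have "0 < 2 * real c" by (simp add: c_def)
  ultimately show ?thesis by blast
qed

end
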